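(* Let $G$ be a $d$-degenerate graph (possibly with parallel edges) with maximum degree $\Delta$ and edge-multiplicity at most $\mu$. Then \[\chi_{\mathrm{con}}(G) \leq \left\lceil \sqrt{d}\cdot 2^{\mu/2+2}\sqrt{\mu}\sqrt{1+\log((d+1)\Delta)}\right\rceil .\]
   Context: Graphs have no loops but may have parallel edges; the edge-multiplicity is the maximum number of parallel edges joining a pair of vertices. Let $C$ be a set of colors. A conflict function $f$ assigns to each edge joining $u$ and $v$ a forbidden ordered pair in $C^2$ (an edge $(u,v)$ with conflict $(c_1,c_2)$ is the same as the edge $(v,u)$ with conflict $(c_2,c_1)$); if $u,v$ are joined by $m$ parallel edges, these receive $m$ (without loss of generality distinct) conflicts, one per edge. A (not necessarily proper) coloring $\phi:V(G)\to C$ is a single-conflict coloring with respect to $f$ and $C$ if for every edge $(u,v)$, $(\phi(u),\phi(v))$ differs from the conflict of that edge. The single-conflict chromatic number $\chi_{\mathrm{con}}(G)$ is the minimum integer $k$ such that for every color set $C$ with $|C|=k$ and every conflict function $f$, $G$ has a single-conflict coloring. A graph is $d$-degenerate if every subgraph has a vertex of degree at most $d$. $\log$ is the natural logarithm. *)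

theory Defs
  imports Complex_Main "HOL-Library.FuncSet"
begin

record ('v, 'e) multigraph =
  verts :: "'v set"
  edges :: "'e set"
  ends :: "'e \<Rightarrow> 'v set"

text \<open>Finite graphs without loops, parallel edges allowed: edges are named, and each
  has an unordered pair of distinct end vertices.\<close>

definition is_multigraph :: "('v, 'e) multigraph \<Rightarrow> bool" where
  "is_multigraph G \<longleftrightarrow> finite (verts G) \<and> finite (edges G) \<and>
     (\<forall>e\<in>edges G. ends G e \<subseteq> verts G \<and> card (ends G e) = 2)"

text \<open>Degrees count parallel edges with multiplicity.\<close>

definition degree :: "('v, 'e) multigraph \<Rightarrow> 'v \<Rightarrow> nat" where
  "degree G v = card {e \<in> edges G. v \<in> ends G e}"

text \<open>Meaningful only for graphs with at least one vertex.\<close>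

definition max_degree :: "('v, 'e) multigraph \<Rightarrow> nat" where
  "max_degree G = Max (degree G ` verts G)"

text \<open>As there are no loops, the pairs with \<open>u = v\<close> contribute \<open>0\<close>; they only keep
  the set nonempty when there is a single vertex.\<close>

definition edge_multiplicity :: "('v, 'e) multigraph \<Rightarrow> nat" where
  "edge_multiplicity G =
     Max ((\<lambda>(u, v). card {e \<in> edges G. ends G e = {u, v}}) ` (verts G \<times> verts G))"

definition is_subgraph :: "('v, 'e) multigraph \<Rightarrow> ('v, 'e) multigraph \<Rightarrow> bool" where
  "is_subgraph H G \<longleftrightarrow> is_multigraph H \<and> verts H \<subseteq> verts G \<and> edges H \<subseteq> edges G \<and>
     (\<forall>e\<in>edges H. ends H e = ends G e)"

definition degenerate :: "nat \<Rightarrow> ('v, 'e) multigraph \<Rightarrow> bool" where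
  "degenerate d G \<longleftrightarrow>
     (\<forall>H. is_subgraph H G \<and> verts H \<noteq> {} \<longrightarrow> (\<exists>v\<in>verts H. degree H v \<le> d))"

text \<open>\<open>f e u v\<close> is the forbidden pair of the edge \<open>e\<close> when it is read as going from
  \<open>u\<close> to \<open>v\<close>; reading it from \<open>v\<close> to \<open>u\<close> swaps the pair. Parallel edges may
  receive equal conflicts: requiring distinct ones would leave no conflict function at all
  when an edge multiplicity exceeds the number of pairs of colors.\<close>

definition conflict_function ::
    "('v, 'e) multigraph \<Rightarrow> 'c set \<Rightarrow> ('e \<Rightarrow> 'v \<Rightarrow> 'v \<Rightarrow> 'c \<times> 'c) \<Rightarrow> bool" where
  "conflict_function G C f \<longleftrightarrow>
     (\<forall>e\<in>edges G. \<forall>u v. ends G e = {u, v} \<longrightarrow>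
        f e u v \<in> C \<times> C \<and> f e v u = prod.swap (f e u v))"

definition single_conflict_coloring ::
    "('v, 'e) multigraph \<Rightarrow> 'c set \<Rightarrow> ('e \<Rightarrow> 'v \<Rightarrow> 'v \<Rightarrow> 'c \<times> 'c) \<Rightarrow> ('v \<Rightarrow> 'c) \<Rightarrow> bool" where
  "single_conflict_coloring G C f \<phi> \<longleftrightarrow> \<phi> \<in> verts G \<rightarrow> C \<and>
     (\<forall>e\<in>edges G. \<forall>u v. ends G e = {u, v} \<longrightarrow> (\<phi> u, \<phi> v) \<noteq> f e u v)"

text \<open>Taking colors from \<open>nat\<close> loses nothing, since every finite set is in bijection
  with a set of natural numbers. The case \<open>k = 0\<close> has to be excluded: over an empty color
  set a graph with an edge has no conflict function, so \<open>0\<close> would qualify vacuously.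
  For \<open>k \<ge> 1\<close>, \<open>card C = k\<close> makes \<open>C\<close> finite.\<close>

definition chi_con :: "('v, 'e) multigraph \<Rightarrow> nat" where
  "chi_con G = (LEAST k. k \<ge> 1 \<and>
     (\<forall>C :: nat set. card C = k \<longrightarrow>
        (\<forall>f. conflict_function G C f \<longrightarrow> (\<exists>\<phi>. single_conflict_coloring G C f \<phi>))))"

end

theory Submission
  imports "HOL-Probability.Product_PMF" Defs
begin

text \<open>
  Order the vertices so that every vertex has at most \<open>d\<close> edges to earlier ones. If there are
  \<open>k > d\<close> colors, color greedily. Otherwise activate every color at every vertex independently
  with probability \<open>p = k / (2 * d)\<close>. It suffices that each vertex \<open>v\<close> has an activated color \<open>c\<close>
  such that no edge from an earlier \<open>u\<close> with conflict \<open>(a, c)\<close> has \<open>a\<close> activated at \<open>u\<close>: giving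
  every \<open>v\<close> such a color avoids all conflicts. For a fixed \<open>v\<close>, the events that the single
  colors \<open>c\<close> fail involve every bit at most \<open>\<mu>\<close> times, so by Hoelder's inequality all of them
  fail with probability at most \<open>exp (- k\<^sup>2 / (4 * d * \<mu>))\<close>. This bad event is determined by
  \<open>v\<close> and its at most \<open>d\<close> earlier neighbours, hence is independent of all but \<open>(d + 1) * \<Delta>\<close>
  others, and the local lemma applies.
\<close>

subsection \<open>Product probabilities\<close>

text \<open>Arithmetic-geometric mean for \<open>m\<close> numbers with equal weights, after padding
  the family by \<open>m - card A\<close> ones; the padding lets families shorter than
  \<open>m\<close> share the exponent \<open>1 / m\<close>.\<close>

lemma weighted_arith_geom_mean_padded:
  fixes x :: "'a \<Rightarrow> real"
  assumes "finite A" "card A \<le> m" "0 < m" and x: "\<And>i. i \<in> A \<Longrightarrow> 0 < x i"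
  shows "(\<Prod>i\<in>A. x i powr (1 / m)) \<le> (\<Sum>i\<in>A. x i) / m + (1 - card A / m)"
proof (cases "A = {}")
  case False
  define a where "a = (\<Sum>i\<in>A. x i) / card A"
  have ca: "card A > 0"
    using False assms by (simp add: card_gt_0_iff)
  have a: "a > 0"
    unfolding a_def using ca False x assms(1) by (intro divide_pos_pos sum_pos) auto
  have "(\<Prod>i\<in>A. x i powr (1 / m)) = (\<Prod>i\<in>A. x i) powr (1 / m)"
    using x by (simp add: prod_powr_distrib less_imp_le)
  also have "\<dots> = ((\<Prod>i\<in>A. x i) powr (1 / card A)) powr (card A / m)"
    using ca by (simp add: powr_powr)
  also have "\<dots> \<le> a powr (card A / m)"
    using arith_geom_mean[OF assms(1) False, of x] x
    by (intro powr_mono2) (auto simp: a_def sum_divide_distrib less_imp_le)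
  \<comment> \<open>The factor \<open>1 powr _\<close> stands for the padding: Young's inequality is
    applied to \<open>a\<close> and \<open>1\<close> with weights \<open>card A / m\<close> and
    \<open>1 - card A / m\<close>.\<close>
  also have "\<dots> = a powr (card A / m) * 1 powr (1 - card A / m)"
    by simp
  also have "\<dots> \<le> (card A / m) * a + (1 - card A / m) * 1"
    using assms a by (intro Youngs_inequality_0) auto
  also have "(card A / m) * a = (\<Sum>i\<in>A. x i) / m"
    using ca by (simp add: a_def)
  finally show ?thesis
    by simp
qed simp

text \<open>Hoelder's inequality for the functions with value \<open>1\<close> at a point of mass
  \<open>q\<close> and \<open>g i\<close> at a point of mass \<open>1 - q\<close>, all with exponent
  \<open>1 / m\<close>.\<close>

lemma two_point_Hoelder:
  fixes g :: "'a \<Rightarrow> real"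
  assumes "finite A" "card A \<le> m" "0 < m" and q: "0 \<le> q" "q \<le> 1"
    and g: "\<And>i. i \<in> A \<Longrightarrow> 0 \<le> g i"
  shows "q + (1 - q) * (\<Prod>i\<in>A. g i powr (1 / m)) \<le> (\<Prod>i\<in>A. (q + (1 - q) * g i) powr (1 / m))"
proof (cases "q = 0")
  case False
  define h where "h i = q + (1 - q) * g i" for i
  have h: "h i > 0" if "i \<in> A" for i
    unfolding h_def using False q g[OF that] by (intro add_pos_nonneg mult_nonneg_nonneg) auto
  define P where "P = (\<Prod>i\<in>A. h i powr (1 / m))"
  have P: "P > 0"
    unfolding P_def by (intro prod_pos) (use h in force)
  show ?thesis
  \<comment> \<open>The padded mean inequality needs positive entries. If some \<open>g i\<close>
    vanishes, so does the product on the left, and only \<open>q\<close> has to be bounded.\<close>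
  proof (cases "\<exists>i\<in>A. g i = 0")
    case True
    then have 0: "(\<Prod>i\<in>A. g i powr (1 / m)) = 0"
      using assms(1) by (intro prod_zero) auto
    have "q \<le> q powr (card A / m)"
      using powr_mono'[of "card A / m" 1 q] assms by simp
    also have "\<dots> = (\<Prod>i\<in>A. q powr (1 / m))"
      using False q by (simp add: powr_powr flip: powr_realpow)
    also have "\<dots> \<le> P"
      unfolding P_def h_def using q g by (intro prod_mono conjI powr_mono2) auto
    finally show ?thesis
      by (simp add: 0 P_def h_def)
  next
    case nz: False
    then have gpos: "g i > 0" if "i \<in> A" for i
      using g that by force
    \<comment> \<open>Dividing by \<open>P\<close> rescales each function to mean \<open>1\<close>,
      so the mean inequalities at the two points average to exactly \<open>1\<close>.\<close>
    have "(q + (1 - q) * (\<Prod>i\<in>A. g i powr (1 / m))) / P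
        = q * (\<Prod>i\<in>A. (1 / h i) powr (1 / m)) + (1 - q) * (\<Prod>i\<in>A. (g i / h i) powr (1 / m))"
      using h gpos unfolding P_def
      by (simp add: add_divide_distrib powr_divide less_imp_le prod_dividef)
    also have "\<dots> \<le> q * ((\<Sum>i\<in>A. 1 / h i) / m + (1 - card A / m))
        + (1 - q) * ((\<Sum>i\<in>A. g i / h i) / m + (1 - card A / m))"
      using q assms h gpos
      by (intro add_mono mult_left_mono weighted_arith_geom_mean_padded) auto
    also have "\<dots> = (\<Sum>i\<in>A. q * (1 / h i) + (1 - q) * (g i / h i)) / m + (1 - card A / m)"
    proof -
      have "(\<Sum>i\<in>A. q * (1 / h i) + (1 - q) * (g i / h i)) =
          q * (\<Sum>i\<in>A. 1 / h i) + (1 - q) * (\<Sum>i\<in>A. g i / h i)"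
        by (simp only: sum.distrib sum_distrib_left)
      moreover have "q * (a / m + b) + (1 - q) * (c / m + b) = (q * a + (1 - q) * c) / m + b"
        for a b c :: real
        by (simp add: add_divide_distrib diff_divide_distrib algebra_simps)
      ultimately show ?thesis
        by (simp only:)
    qed
    also have "(\<Sum>i\<in>A. q * (1 / h i) + (1 - q) * (g i / h i)) = (\<Sum>i\<in>A. 1)"
    proof (intro sum.cong refl)
      fix i assume "i \<in> A"
      then show "q * (1 / h i) + (1 - q) * (g i / h i) = 1"
        using h[of i] by (simp add: divide_simps) (simp add: h_def)
    qed
    finally show ?thesis
      using P by (simp add: P_def h_def)
  qed
qed (use assms in simp)

section \<open>Events under product distributions\<close>

lemma prob_pair_pmf_Times:
  "measure_pmf.prob (pair_pmf M N) (A \<times> B) = measure_pmf.prob M A * measure_pmf.prob N B"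
proof -
  \<comment> \<open>Cutting both factors down to the supports makes them countable.\<close>
  have "measure_pmf.prob (pair_pmf M N) (A \<times> B)
      = measure_pmf.prob (pair_pmf M N) ((A \<inter> set_pmf M) \<times> (B \<inter> set_pmf N))"
    by (subst measure_Int_set_pmf[symmetric]) (auto intro!: arg_cong[where f="measure_pmf.prob _"])
  then show ?thesis
    by (simp add: measure_pmf_prob_product measure_Int_set_pmf)
qed

text \<open>Total probability, conditioning on whether coordinate \<open>j\<close> falls into
  \<open>T\<close>: in either case membership in \<open>E\<close> is decided by the other
  coordinates.\<close>

lemma prob_Pi_pmf_insert:
  assumes "finite J" "j \<notin> J"
    and "\<And>y x. y \<in> T \<Longrightarrow> x(j := y) \<in> E \<longleftrightarrow> x \<in> E1"
    and "\<And>y x. y \<notin> T \<Longrightarrow> x(j := y) \<in> E \<longleftrightarrow> x \<in> E2"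
  shows "measure_pmf.prob (Pi_pmf (insert j J) d D) E =
    measure_pmf.prob (D j) T * measure_pmf.prob (Pi_pmf J d D) E1 +
    (1 - measure_pmf.prob (D j) T) * measure_pmf.prob (Pi_pmf J d D) E2"
proof -
  let ?p = "pair_pmf (D j) (Pi_pmf J d D)"
  have "measure_pmf.prob (Pi_pmf (insert j J) d D) E =
      measure_pmf.prob ?p (T \<times> E1 \<union> (- T) \<times> E2)"
    using assms by (auto simp: Pi_pmf_insert intro!: arg_cong[where f="measure_pmf.prob _"])
  also have "\<dots> = measure_pmf.prob ?p (T \<times> E1) + measure_pmf.prob ?p ((- T) \<times> E2)"
    by (intro measure_pmf.finite_measure_Union) auto
  finally show ?thesis
    using measure_pmf.prob_compl[of T "D j"]
    by (simp add: prob_pair_pmf_Times Compl_eq_Diff_UNIV)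
qed

text \<open>Conditioning on one coordinate is the two-point case of Hoelder's inequality, which needs
  that no coordinate occurs in more than \<open>m\<close> of the events.\<close>

lemma prob_Pi_pmf_hit_all_le:
  fixes N :: "'c \<Rightarrow> 'j set" and T :: "'j \<Rightarrow> 'b set"
  assumes "finite J" "finite C" "0 < m" "\<And>c. c \<in> C \<Longrightarrow> N c \<subseteq> J"
    and "\<And>j. j \<in> J \<Longrightarrow> card {c \<in> C. j \<in> N c} \<le> m"
  shows "measure_pmf.prob (Pi_pmf J d D) {x. \<forall>c\<in>C. \<exists>j\<in>N c. x j \<in> T j} \<le>
    (\<Prod>c\<in>C. (1 - (\<Prod>j\<in>N c. 1 - measure_pmf.prob (D j) (T j))) powr (1 / m))"
  using assms
proof (induction J arbitrary: C N rule: finite_induct)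
  case empty
  show ?case
  proof (cases "C = {}")
    case False
    with empty have "{x. \<forall>c\<in>C. \<exists>j\<in>N c. x j \<in> T j} = {}"
      by auto
    then show ?thesis
      by (simp add: prod_nonneg)
  qed simp
next
  case (insert j J)
  define A where "A = {c \<in> C. j \<in> N c}"
  define q where "q i = measure_pmf.prob (D i) (T i)" for i
  have q: "0 \<le> q i" "q i \<le> 1" for i
    by (auto simp: q_def)
  define M where "M = Pi_pmf J d D"
  \<comment> \<open>The probability that some coordinate in \<open>N c\<close> is hit, the
    coordinates being independent.\<close>
  define f where "f N c = 1 - (\<Prod>i\<in>N c. 1 - q i)" for N and c :: 'c
  have f: "0 \<le> f N c" for N c
    unfolding f_def using q by (simp add: prod_le_1)
  define E where "E C N = {x. \<forall>c\<in>C. \<exists>j\<in>N c. x j \<in> T j}" for C and N :: "'c \<Rightarrow> 'j set"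
  define N' where "N' c = N c - {j}" for c
  have A: "A \<subseteq> C" "finite A" "card A \<le> m"
    using insert.prems(4)[of j] insert.prems(1) by (auto simp: A_def)
  have card_le: "card X \<le> m" if "i \<in> J" "X \<subseteq> {c \<in> C. i \<in> N c}" for i X
    using card_mono[OF _ that(2)] insert.prems(1) insert.prems(4)[of i] that(1) by force
  \<comment> \<open>A hit at \<open>j\<close> settles all events in \<open>A\<close> at once and
    leaves those in \<open>C - A\<close>; a miss deletes \<open>j\<close> from every
    \<open>N c\<close>. \<open>E1\<close> and \<open>E2\<close> are the induction hypotheses for
    these two cases.\<close>
  have E1: "measure_pmf.prob M (E (C - A) N) \<le> (\<Prod>c\<in>C - A. f N c powr (1 / m))"
    unfolding M_def E_def f_def q_def
  proof (rule insert.IH[of "C - A" N])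
    fix i assume "i \<in> J"
    then show "card {c \<in> C - A. i \<in> N c} \<le> m"
      by (rule card_le) auto
  next
    fix c assume "c \<in> C - A"
    then show "N c \<subseteq> J"
      using insert.prems(3)[of c] by (auto simp: A_def)
  qed (use insert.prems(1,2) in auto)
  have E2: "measure_pmf.prob M (E C N') \<le> (\<Prod>c\<in>C. f N' c powr (1 / m))"
    unfolding M_def E_def f_def q_def
  proof (rule insert.IH[of C N'])
    fix i assume "i \<in> J"
    then show "card {c \<in> C. i \<in> N' c} \<le> m"
      by (rule card_le) (auto simp: N'_def)
  next
    fix c assume "c \<in> C"
    then show "N' c \<subseteq> J"
      using insert.prems(3)[of c] by (auto simp: N'_def)
  qed (use insert.prems(1,2) in auto)
  have split: "(\<Prod>c\<in>C. h c) = (\<Prod>c\<in>C - A. h c) * (\<Prod>c\<in>A. h c)" for h :: "'c \<Rightarrow> real"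
    using A insert.prems by (simp add: prod.subset_diff)
  \<comment> \<open>This recursion has the shape of the factors on the right of
    \<open>two_point_Hoelder\<close>, with \<open>g = f N'\<close>.\<close>
  have f_A: "f N c = q j + (1 - q j) * f N' c" if "c \<in> A" for c
  proof -
    have "finite (N c)"
      using that A insert.prems insert.hyps finite_subset[of "N c" "insert j J"] by auto
    then show ?thesis
      using that by (simp add: f_def N'_def A_def prod.remove[of "N c" j] algebra_simps)
  qed
  have f_nA: "f N' c = f N c" if "c \<in> C - A" for c
    using that by (simp add: f_def N'_def A_def)
  define R where "R = (\<Prod>c\<in>C - A. f N c powr (1 / m))"
  have R: "R \<ge> 0"
    by (simp add: R_def prod_nonneg)
  have "measure_pmf.prob (Pi_pmf (insert j J) d D) (E C N) =
      q j * measure_pmf.prob M (E (C - A) N) + (1 - q j) * measure_pmf.prob M (E C N')"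
    unfolding M_def q_def
  proof (intro prob_Pi_pmf_insert)
    fix y and x :: "'j \<Rightarrow> 'b" assume "y \<in> T j"
    then show "x(j := y) \<in> E C N \<longleftrightarrow> x \<in> E (C - A) N"
      unfolding E_def A_def by (fastforce split: if_splits)
  next
    fix y and x :: "'j \<Rightarrow> 'b" assume "y \<notin> T j"
    then show "x(j := y) \<in> E C N \<longleftrightarrow> x \<in> E C N'"
      unfolding E_def N'_def by (fastforce split: if_splits)
  qed (use insert.hyps in auto)
  also have "\<dots> \<le> q j * R + (1 - q j) * (\<Prod>c\<in>C. f N' c powr (1 / m))"
    unfolding R_def using E1 E2 q by (intro add_mono mult_left_mono) auto
  also have "(\<Prod>c\<in>C. f N' c powr (1 / m)) = R * (\<Prod>c\<in>A. f N' c powr (1 / m))"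
    unfolding split R_def using f_nA by simp
  also have "q j * R + (1 - q j) * (R * (\<Prod>c\<in>A. f N' c powr (1 / m))) =
      R * (q j + (1 - q j) * (\<Prod>c\<in>A. f N' c powr (1 / m)))"
    by (simp add: algebra_simps)
  also have "\<dots> \<le> R * (\<Prod>c\<in>A. (q j + (1 - q j) * f N' c) powr (1 / m))"
    using A q f R insert.prems by (intro mult_left_mono two_point_Hoelder) auto
  also have "\<dots> = (\<Prod>c\<in>C. f N c powr (1 / m))"
    unfolding split R_def using f_A by simp
  finally show ?case
    by (simp add: E_def f_def q_def)
qed

subsection \<open>The local lemma\<close>

text \<open>By induction, a bad event has conditional probability at most \<open>2 * q\<close> given
  that any set of other bad events is avoided. As \<open>2 * q < 1\<close>, the events can then be
  avoided one after the other.\<close>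

lemma lovasz_local_lemma_symmetric:
  fixes M :: "'a pmf" and A :: "'i \<Rightarrow> 'a set" and nb :: "'i \<Rightarrow> 'i set" and q :: real
  assumes "finite I"
    and nb: "\<And>i. i \<in> I \<Longrightarrow> card (nb i \<inter> I) \<le> n"
    and q: "\<And>i. i \<in> I \<Longrightarrow> measure_pmf.prob M (A i) \<le> q"
    and qn: "4 * q * n \<le> 1" "1 \<le> n"
    and indep: "\<And>i K. \<lbrakk>i \<in> I; K \<subseteq> I - nb i; i \<notin> K\<rbrakk> \<Longrightarrow>
      measure_pmf.prob M (A i \<inter> - \<Union> (A ` K)) =
      measure_pmf.prob M (A i) * measure_pmf.prob M (- \<Union> (A ` K))"
  shows "\<exists>x. x \<notin> \<Union> (A ` I)"
proof -
  let ?P = "measure_pmf.prob M"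
  define B where "B K = - \<Union> (A ` K)" for K
  text \<open>A union bound over the neighbours of \<open>i\<close> in \<open>K\<close> replaces the usual chain rule, so that
    conditional probabilities are not needed.\<close>
  have step: "?P (A i \<inter> B K) \<le> 2 * q * ?P (B K)" if "i \<in> I" "K \<subseteq> I" "i \<notin> K" for i K
    using that
  proof (induction "card K" arbitrary: i K rule: less_induct)
    case less
    have finK: "finite K"
      using less.prems \<open>finite I\<close> finite_subset by blast
    have q0: "0 \<le> q"
      using q[of i] less.prems measure_nonneg[of M "A i"] by linarith
    define K1 where "K1 = K \<inter> nb i"
    define K2 where "K2 = K - nb i"
    have "?P (A i \<inter> B K) \<le> ?P (A i \<inter> B K2)"
      by (intro measure_pmf.finite_measure_mono) (auto simp: B_def K2_def)
    also have "\<dots> = ?P (A i) * ?P (B K2)"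
      unfolding B_def using less.prems by (intro indep) (auto simp: K2_def)
    also have "\<dots> \<le> q * ?P (B K2)"
      using q[of i] less.prems by (intro mult_right_mono) auto
    finally have 1: "?P (A i \<inter> B K) \<le> q * ?P (B K2)" .
    have "?P (B K2) \<le> ?P (B K \<union> (\<Union>j\<in>K1. A j \<inter> B K2))"
      by (intro measure_pmf.finite_measure_mono) (auto simp: B_def K2_def K1_def)
    also have "\<dots> \<le> ?P (B K) + ?P (\<Union>j\<in>K1. A j \<inter> B K2)"
      by (intro measure_Un_le) auto
    also have "?P (\<Union>j\<in>K1. A j \<inter> B K2) \<le> (\<Sum>j\<in>K1. ?P (A j \<inter> B K2))"
      using finK by (intro measure_pmf.finite_measure_subadditive_finite) (auto simp: K1_def)
    also have "\<dots> \<le> (\<Sum>j\<in>K1. 2 * q * ?P (B K2))"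
    proof (intro sum_mono less.hyps)
      fix j assume "j \<in> K1"
      \<comment> \<open>The induction hypothesis is only invoked when a neighbour \<open>j\<close>
        lies in \<open>K\<close>, which makes \<open>K2\<close> strictly smaller.\<close>
      then have "K2 \<subset> K"
        by (auto simp: K1_def K2_def)
      then show "card K2 < card K"
        using finK by (simp add: psubset_card_mono)
    qed (use less.prems in \<open>auto simp: K1_def K2_def\<close>)
    also have "\<dots> = card K1 * (2 * q * ?P (B K2))"
      by simp
    also have "\<dots> \<le> n * (2 * q * ?P (B K2))"
    proof -
      have "card K1 \<le> card (nb i \<inter> I)"
        using less.prems \<open>finite I\<close> by (intro card_mono) (auto simp: K1_def)
      also have "\<dots> \<le> n"
        using nb less.prems by blast
      finally show ?thesis
        using q0 by (intro mult_right_mono) auto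
    qed
    \<comment> \<open>The neighbours cost at most half of \<open>?P (B K2)\<close>; absorbing that
      half on the left produces the factor \<open>2\<close> in the bound
      \<open>2 * q\<close>.\<close>
    also have "\<dots> = (4 * q * n) * (?P (B K2) / 2)"
      by simp
    also have "\<dots> \<le> 1 * (?P (B K2) / 2)"
      using qn by (intro mult_right_mono) auto
    finally have "?P (B K2) \<le> 2 * ?P (B K)"
      by simp
    then have "q * ?P (B K2) \<le> q * (2 * ?P (B K))"
      using q0 by (intro mult_left_mono)
    with 1 show ?case
      by simp
  qed
  have "?P (B K) > 0" if "finite K" "K \<subseteq> I" for K
    using that
  proof (induction rule: finite_induct)
    case (insert i K)
    have "0 \<le> q"
      using order_trans[OF measure_nonneg q[of i]] insert.prems by simp
    then have "4 * q * 1 \<le> 4 * q * n"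
      using qn(2) by (intro mult_left_mono) auto
    with qn have "2 * q < 1"
      by linarith
    have "?P (B K) \<le> ?P (B (insert i K) \<union> (A i \<inter> B K))"
      by (intro measure_pmf.finite_measure_mono) (auto simp: B_def)
    also have "\<dots> \<le> ?P (B (insert i K)) + ?P (A i \<inter> B K)"
      by (intro measure_Un_le) auto
    also have "?P (A i \<inter> B K) \<le> 2 * q * ?P (B K)"
      using insert by (intro step) auto
    finally have "(1 - 2 * q) * ?P (B K) \<le> ?P (B (insert i K))"
      by (simp add: algebra_simps)
    moreover have "(1 - 2 * q) * ?P (B K) > 0"
      using \<open>2 * q < 1\<close> insert by (intro mult_pos_pos) auto
    ultimately show ?case
      by linarith
  qed (simp add: B_def)
  from this[of I] have "B I \<noteq> {}"
    using \<open>finite I\<close> by force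
  then show ?thesis
    by (auto simp: B_def)
qed

text \<open>Split the product into the coordinates inside and outside \<open>K\<close>:
  \<open>A\<close> then depends on the first factor only and \<open>B\<close> on the second.\<close>

lemma prob_Pi_pmf_Int_indep:
  assumes "finite J"
    and A: "\<And>x y. (\<And>j. j \<in> K \<Longrightarrow> x j = y j) \<Longrightarrow> x \<in> A \<longleftrightarrow> y \<in> A"
    and B: "\<And>x y. (\<And>j. j \<notin> K \<Longrightarrow> x j = y j) \<Longrightarrow> x \<in> B \<longleftrightarrow> y \<in> B"
  shows "measure_pmf.prob (Pi_pmf J d D) (A \<inter> B) =
    measure_pmf.prob (Pi_pmf J d D) A * measure_pmf.prob (Pi_pmf J d D) B"
proof -
  define M where "M = Pi_pmf (J \<inter> K) d D"
  define N where "N = Pi_pmf (J - K) d D"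
  define h where "h = (\<lambda>(f, g) x. if x \<in> J \<inter> K then f x else g x :: 'b)"
  have eq: "Pi_pmf J d D = map_pmf h (pair_pmf M N)"
    using Pi_pmf_union[of "J \<inter> K" "J - K" d D] \<open>finite J\<close>
    by (simp add: M_def N_def h_def Int_Diff_Un Int_Diff_disjoint)
  \<comment> \<open>Coordinates in \<open>K\<close> outside \<open>J\<close> have the default value
    \<open>d\<close> in both factors, so \<open>h (f, g)\<close> agrees with \<open>f\<close> on all
    of \<open>K\<close>.\<close>
  have set: "f x = d" if "(f, g) \<in> set_pmf (pair_pmf M N)" "x \<notin> J \<inter> K" for f g x
    using that set_Pi_pmf_subset[of "J \<inter> K" d D] \<open>finite J\<close> by (auto simp: M_def)
  have set': "g x = d" if "(f, g) \<in> set_pmf (pair_pmf M N)" "x \<notin> J - K" for f g x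
    using that set_Pi_pmf_subset[of "J - K" d D] \<open>finite J\<close> by (auto simp: N_def)
  have hA: "h (f, g) \<in> A \<longleftrightarrow> f \<in> A" if "(f, g) \<in> set_pmf (pair_pmf M N)" for f g
    by (rule A) (use set[OF that] set'[OF that] in \<open>auto simp: h_def\<close>)
  have hB: "h (f, g) \<in> B \<longleftrightarrow> g \<in> B" if "(f, g) \<in> set_pmf (pair_pmf M N)" for f g
    by (rule B) (auto simp: h_def)
  have *: "measure_pmf.prob (Pi_pmf J d D) (X \<inter> Y) = measure_pmf.prob M X * measure_pmf.prob N Y"
    if "\<And>f g. (f, g) \<in> set_pmf (pair_pmf M N) \<Longrightarrow> h (f, g) \<in> X \<longleftrightarrow> f \<in> X"
       "\<And>f g. (f, g) \<in> set_pmf (pair_pmf M N) \<Longrightarrow> h (f, g) \<in> Y \<longleftrightarrow> g \<in> Y" for X Y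
  proof -
    have "measure_pmf.prob (Pi_pmf J d D) (X \<inter> Y) =
        measure_pmf.prob (pair_pmf M N) (h -` (X \<inter> Y) \<inter> set_pmf (pair_pmf M N))"
      by (simp only: eq measure_map_pmf measure_Int_set_pmf)
    also have "h -` (X \<inter> Y) \<inter> set_pmf (pair_pmf M N) = (X \<times> Y) \<inter> set_pmf (pair_pmf M N)"
      using that by (auto simp del: set_pair_pmf)
    finally show ?thesis
      by (simp only: measure_Int_set_pmf prob_pair_pmf_Times)
  qed
  show ?thesis
    \<comment> \<open>Taking \<open>UNIV\<close> for one event identifies the two marginal
      probabilities.\<close>
    using *[OF hA hB] *[of A UNIV] *[of UNIV B] hA hB by simp
qed

section \<open>Random activation of colors\<close>

text \<open>\<open>(u, a, c) \<in> B v\<close> stands for an edge from the earlier vertex \<open>u\<close> to \<open>v\<close> with conflict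
  \<open>(a, c)\<close>, and \<open>S (v, c)\<close> says that \<open>c\<close> is activated at \<open>v\<close>.\<close>

lemma exists_unblocked_choice:
  fixes B :: "'v \<Rightarrow> ('v \<times> 'c \<times> 'c) set" and V :: "'v set" and C :: "'c set"
  assumes V: "finite V" and C: "finite C"
    and B: "\<And>v. v \<in> V \<Longrightarrow> B v \<subseteq> V \<times> C \<times> C" "\<And>v. v \<in> V \<Longrightarrow> v \<notin> fst ` B v"
    and card_B: "\<And>v. v \<in> V \<Longrightarrow> card (B v) \<le> d"
    and mult: "\<And>u v. v \<in> V \<Longrightarrow> card {t \<in> B v. fst t = u} \<le> m"
    and deg: "\<And>u. u \<in> V \<Longrightarrow> card {v \<in> V. u \<in> fst ` B v} \<le> D"
    and pos: "0 < m" "0 < D" "0 < d" "card C \<le> d"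
    and small: "4 * exp (- (real (card C))\<^sup>2 / (4 * d * m)) * ((d + 1) * D) \<le> 1"
  shows "\<exists>S. \<forall>v\<in>V. \<exists>c\<in>C. S (v, c) \<and> (\<forall>u a. (u, a, c) \<in> B v \<longrightarrow> \<not> S (u, a))"
proof -
  \<comment> \<open>maximizes \<open>card C * p - p\<^sup>2 * d\<close>, the exponent (times \<open>m\<close>) reached below\<close>
  define p where "p = card C / (2 * d)"
  have p: "0 \<le> p" "p \<le> 1"
    using pos by (auto simp: p_def divide_simps)
  define M where "M = Pi_pmf (V \<times> C) False (\<lambda>_. bernoulli_pmf p)"
  define Q where "Q v c = {(u, a). (u, a, c) \<in> B v}" for v c
  define N where "N v c = insert (v, c) (Q v c)" for v c
  \<comment> \<open>\<open>c\<close> is unusable at \<open>v\<close> iff \<open>(v, c)\<close> is off or some \<open>j \<in> Q v c\<close> is on, i.e.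
    iff \<open>x j \<in> T v j\<close> for some \<open>j \<in> N v c\<close>\<close>
  define T where "T v = (\<lambda>(w, c :: 'c). {w \<noteq> v})" for v :: 'v
  define A where "A v = {x. \<forall>c\<in>C. \<exists>j\<in>N v c. x j \<in> T v j}" for v
  \<comment> \<open>The vertices whose bits determine \<open>A v\<close>; two events are treated as
    dependent when these sets meet.\<close>
  define cl where "cl v = insert v (fst ` B v)" for v
  define nb where "nb v = {w \<in> V. w \<noteq> v \<and> cl w \<inter> cl v \<noteq> {}}" for v
  have finB: "finite (B v)" if "v \<in> V" for v
    using finite_subset[OF B(1)[OF that]] V C by simp
  have Q_sub: "Q v c \<subseteq> V \<times> C" if "v \<in> V" for v c
    using B(1)[OF that] by (auto simp: Q_def)
  have finQ: "finite (Q v c)" if "v \<in> V" for v c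
    using finite_subset[OF Q_sub[OF that]] V C by auto
  have notQ: "(v, a) \<notin> Q v c" if "v \<in> V" for v c a
    using B(2)[OF that] by (force simp: Q_def)
  have prob_A: "measure_pmf.prob M (A v) \<le> exp (- (real (card C))\<^sup>2 / (4 * d * m))"
    if v: "v \<in> V" for v
  proof -
    have "measure_pmf.prob M (A v) \<le>
        (\<Prod>c\<in>C. (1 - (\<Prod>j\<in>N v c. 1 - measure_pmf.prob (bernoulli_pmf p) (T v j))) powr (1 / m))"
      unfolding M_def A_def
    proof (rule prob_Pi_pmf_hit_all_le)
      show "N v c \<subseteq> V \<times> C" if "c \<in> C" for c
        using Q_sub[OF v] v that by (auto simp: N_def)
      \<comment> \<open>A bit at \<open>v\<close> itself matters for one color only; a bit at
        another vertex \<open>u\<close> matters for at most as many colors as \<open>B v\<close> has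
        triples starting with \<open>u\<close>.\<close>
      show "card {c \<in> C. j \<in> N v c} \<le> m" for j
      proof (cases "fst j = v")
        case True
        have "{c \<in> C. j \<in> N v c} \<subseteq> {snd j}"
          using notQ[OF v, of "snd j"] True by (cases j) (auto simp: N_def)
        then have "card {c \<in> C. j \<in> N v c} \<le> 1"
          using card_mono[of "{snd j}"] by force
        then show ?thesis
          using pos by linarith
      next
        case False
        have "(\<lambda>c. (fst j, snd j, c)) ` {c \<in> C. j \<in> N v c} \<subseteq> {t \<in> B v. fst t = fst j}"
          using False by (auto simp: N_def Q_def)
        then have "card {c \<in> C. j \<in> N v c} \<le> card {t \<in> B v. fst t = fst j}"
          using finB[OF v] by (intro card_inj_on_le[of "\<lambda>c. (fst j, snd j, c)"]) (auto simp: inj_on_def)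
        then show ?thesis
          using mult[OF v, of "fst j"] by linarith
      qed
    qed (use V C pos in auto)
    also have "\<dots> \<le> (\<Prod>c\<in>C. exp (- (p - p\<^sup>2 * card (Q v c)) / m))"
    proof (intro prod_mono conjI)
      fix c
      \<comment> \<open>Usability of \<open>c\<close> requires the bit \<open>(v, c)\<close> to be
        on, with probability \<open>p\<close>, and each bit in \<open>Q v c\<close> to be off, with
        probability \<open>1 - p\<close>.\<close>
      have "(\<Prod>j\<in>N v c. 1 - measure_pmf.prob (bernoulli_pmf p) (T v j)) =
          p * (\<Prod>j\<in>Q v c. 1 - measure_pmf.prob (bernoulli_pmf p) (T v j))"
        using p notQ[OF v] finQ[OF v] by (simp add: N_def T_def measure_pmf_single)
      also have "(\<Prod>j\<in>Q v c. 1 - measure_pmf.prob (bernoulli_pmf p) (T v j)) = (\<Prod>j\<in>Q v c. 1 - p)"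
      proof (intro prod.cong refl)
        fix j assume "j \<in> Q v c"
        then have "fst j \<noteq> v"
          using notQ[OF v] by (metis prod.collapse)
        then show "1 - measure_pmf.prob (bernoulli_pmf p) (T v j) = 1 - p"
          using p by (simp add: T_def case_prod_beta measure_pmf_single)
      qed
      finally have eq: "(\<Prod>j\<in>N v c. 1 - measure_pmf.prob (bernoulli_pmf p) (T v j)) =
          p * (1 - p) ^ card (Q v c)"
        by simp
      \<comment> \<open>Linearizing in \<open>card (Q v c)\<close> lets the exponents be added over
        all colors, where only the total number of conflicts matters.\<close>
      have "1 - p * card (Q v c) \<le> (1 - p) ^ card (Q v c)"
        using Bernoulli_inequality[of "- p" "card (Q v c)"] p by (simp add: mult.commute)
      then have "p * (1 - p * card (Q v c)) \<le> p * (1 - p) ^ card (Q v c)"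
        using p by (intro mult_left_mono) auto
      then have "1 - p * (1 - p) ^ card (Q v c) \<le> 1 + - (p - p\<^sup>2 * card (Q v c))"
        by (simp add: algebra_simps power2_eq_square)
      also have "\<dots> \<le> exp (- (p - p\<^sup>2 * card (Q v c)))"
        by (rule exp_ge_add_one_self)
      finally have le: "1 - p * (1 - p) ^ card (Q v c) \<le> exp (- (p - p\<^sup>2 * card (Q v c)))" .
      have "p * (1 - p) ^ card (Q v c) \<le> 1"
        using p by (intro mult_le_one power_le_one) auto
      then have "(1 - p * (1 - p) ^ card (Q v c)) powr (1 / m) \<le>
          exp (- (p - p\<^sup>2 * card (Q v c))) powr (1 / m)"
        using le by (intro powr_mono2) auto
      then show "(1 - (\<Prod>j\<in>N v c. 1 - measure_pmf.prob (bernoulli_pmf p) (T v j))) powr (1 / m) \<le>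
          exp (- (p - p\<^sup>2 * card (Q v c)) / m)"
        by (simp add: eq exp_powr_real)
    qed auto
    also have "\<dots> = exp (- (card C * p - p\<^sup>2 * (\<Sum>c\<in>C. card (Q v c))) / m)"
      using C by (simp add: sum_negf sum_subtractf sum_distrib_left flip: exp_sum sum_divide_distrib)
    also have "\<dots> \<le> exp (- (card C * p - p\<^sup>2 * d) / m)"
    proof -
      have "(\<Sum>c\<in>C. card (Q v c)) = card (SIGMA c:C. Q v c)"
        using C finQ[OF v] by simp
      also have "\<dots> \<le> card (B v)"
        using finB[OF v]
        by (intro card_inj_on_le[of "\<lambda>(c, u, a). (u, a, c)"]) (auto simp: inj_on_def Q_def)
      also have "\<dots> \<le> d"
        using card_B[OF v] .
      finally have "p\<^sup>2 * real (\<Sum>c\<in>C. card (Q v c)) \<le> p\<^sup>2 * d"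
        by (intro mult_left_mono) (auto simp flip: of_nat_sum)
      then show ?thesis
        using pos by (simp add: divide_right_mono)
    qed
    also have "- (card C * p - p\<^sup>2 * d) / m = - (real (card C))\<^sup>2 / (4 * d * m)"
      using pos by (simp add: p_def power2_eq_square field_simps)
    finally show ?thesis .
  qed
  have card_nb: "card (nb v \<inter> V) \<le> (d + 1) * D" if v: "v \<in> V" for v
  proof -
    define Z where "Z z = {w \<in> V. w \<noteq> v \<and> z \<in> cl w}" for z
    have cl_sub: "cl v \<subseteq> V" and fin_cl: "finite (cl v)"
      using B(1)[OF v] v finB[OF v] by (auto simp: cl_def)
    have "card (Z z) \<le> D" if z: "z \<in> cl v" for z
    proof (cases "z = v")
      case True
      then have "Z z \<subseteq> {w \<in> V. z \<in> fst ` B w}"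
        by (auto simp: Z_def cl_def)
      then show ?thesis
        using deg[OF v] True V card_mono[of "{w \<in> V. z \<in> fst ` B w}" "Z z"] by force
    next
      case False
      with z cl_sub have zV: "z \<in> V" and zB: "z \<in> fst ` B v"
        by (auto simp: cl_def)
      let ?X = "{w \<in> V. z \<in> fst ` B w}"
      \<comment> \<open>The additional candidate \<open>w = z\<close> is offset by \<open>v\<close>,
        which lies in \<open>?X\<close> but is excluded from \<open>Z z\<close>; so the bound
        remains \<open>D\<close> rather than \<open>D + 1\<close>.\<close>
      have "Z z \<subseteq> insert z (?X - {v})"
        by (auto simp: Z_def cl_def)
      then have "card (Z z) \<le> card (insert z (?X - {v}))"
        using V by (intro card_mono) auto
      also have "\<dots> \<le> Suc (card (?X - {v}))"
        by (rule card_insert_le_m1) auto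
      also have "\<dots> = card ?X"
        using V v zB by (intro card_Suc_Diff1) auto
      also have "\<dots> \<le> D"
        by (rule deg[OF zV])
      finally show ?thesis .
    qed
    then have "(\<Sum>z\<in>cl v. card (Z z)) \<le> (\<Sum>z\<in>cl v. D)"
      by (intro sum_mono)
    moreover have "card (nb v \<inter> V) \<le> card (\<Union>z\<in>cl v. Z z)"
      using V fin_cl by (intro card_mono) (auto simp: nb_def Z_def)
    moreover have "card (\<Union>z\<in>cl v. Z z) \<le> (\<Sum>z\<in>cl v. card (Z z))"
      using fin_cl by (rule card_UN_le)
    moreover have "card (cl v) \<le> d + 1"
    proof -
      have "card (cl v) \<le> Suc (card (fst ` B v))"
        unfolding cl_def by (rule card_insert_le_m1) auto
      also have "card (fst ` B v) \<le> card (B v)"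
        using finB[OF v] by (rule card_image_le)
      finally show ?thesis
        using card_B[OF v] by simp
    qed
    then have "card (cl v) * D \<le> (d + 1) * D"
      by (rule mult_le_mono1)
    ultimately show ?thesis
      by simp
  qed
  have A_cong: "x \<in> A v \<longleftrightarrow> y \<in> A v" if "\<And>j. fst j \<in> cl v \<Longrightarrow> x j = y j" for x y v
  proof -
    have "x j = y j" if "j \<in> N v c" for j c
      using that \<open>\<And>j. fst j \<in> cl v \<Longrightarrow> x j = y j\<close>[of j] by (force simp: N_def Q_def cl_def)
    then show ?thesis
      by (auto simp: A_def)
  qed
  have "\<exists>x. x \<notin> \<Union> (A ` V)"
  proof (rule lovasz_local_lemma_symmetric[where M = M and A = A and nb = nb and n = "(d + 1) * D"])
    fix v K assume K: "v \<in> V" "K \<subseteq> V - nb v" "v \<notin> K"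
    show "measure_pmf.prob M (A v \<inter> - \<Union> (A ` K)) =
        measure_pmf.prob M (A v) * measure_pmf.prob M (- \<Union> (A ` K))"
      unfolding M_def
    proof (rule prob_Pi_pmf_Int_indep[where K = "{j. fst j \<in> cl v}" and A = "A v" and B = "- \<Union> (A ` K)"])
      show "finite (V \<times> C)"
        using V C by simp
      show "x \<in> A v \<longleftrightarrow> y \<in> A v" if "\<And>j. j \<in> {j. fst j \<in> cl v} \<Longrightarrow> x j = y j" for x y
        using that by (intro A_cong) auto
      fix x y :: "'v \<times> 'c \<Rightarrow> bool"
      assume xy: "\<And>j. j \<notin> {j. fst j \<in> cl v} \<Longrightarrow> x j = y j"
      have "x \<in> A w \<longleftrightarrow> y \<in> A w" if "w \<in> K" for w
      proof (rule A_cong)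
        fix j :: "'v \<times> 'c" assume "fst j \<in> cl w"
        \<comment> \<open>Since \<open>nb v\<close> leaves out \<open>v\<close> itself, this also
          uses \<open>v \<notin> K\<close>.\<close>
        moreover have "cl w \<inter> cl v = {}"
          using K that by (auto simp: nb_def)
        ultimately show "x j = y j"
          using xy[of j] by auto
      qed
      then show "x \<in> - \<Union> (A ` K) \<longleftrightarrow> y \<in> - \<Union> (A ` K)"
        by auto
    qed
  qed (use V prob_A card_nb pos small in auto)
  then obtain S where S: "\<And>v. v \<in> V \<Longrightarrow> S \<notin> A v"
    by auto
  show ?thesis
  proof (intro exI[of _ S] ballI)
    fix v assume v: "v \<in> V"
    then obtain c where c: "c \<in> C" "\<And>j. j \<in> N v c \<Longrightarrow> S j \<notin> T v j"
      using S[OF v] by (auto simp: A_def)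
    have "S (v, c)"
      using c(2)[of "(v, c)"] by (simp add: N_def T_def)
    moreover have "\<not> S (u, a)" if "(u, a, c) \<in> B v" for u a
    proof -
      have "u \<noteq> v"
        using that B(2)[OF v] by force
      then show ?thesis
        using c(2)[of "(u, a)"] that by (simp add: N_def Q_def T_def)
    qed
    ultimately show "\<exists>c\<in>C. S (v, c) \<and> (\<forall>u a. (u, a, c) \<in> B v \<longrightarrow> \<not> S (u, a))"
      using c(1) by blast
  qed
qed

subsection \<open>Colorings\<close>

text \<open>Repeatedly delete a vertex of degree at most \<open>d\<close> from the subgraph induced
  on the remaining vertices; read backwards, this adds vertices with at most \<open>d\<close> edges
  to what is already there.\<close>

lemma degenerate_induct [consumes 3, case_names empty insert]:
  assumes G: "is_multigraph G" "degenerate d G" and "W \<subseteq> verts G"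
    and "P {}"
    and step: "\<And>v W. \<lbrakk>insert v W \<subseteq> verts G; v \<notin> W;
      card {e \<in> edges G. v \<in> ends G e \<and> ends G e \<subseteq> insert v W} \<le> d; P W\<rbrakk> \<Longrightarrow> P (insert v W)"
  shows "P W"
  using \<open>W \<subseteq> verts G\<close>
proof (induction "card W" arbitrary: W)
  case 0
  then have "W = {}"
    using G(1) finite_subset by (fastforce simp: is_multigraph_def)
  then show ?case
    using \<open>P {}\<close> by simp
next
  case (Suc n)
  define H where "H = G\<lparr>verts := W, edges := {e \<in> edges G. ends G e \<subseteq> W}\<rparr>"
  have "finite W"
    using G(1) Suc.prems finite_subset by (auto simp: is_multigraph_def)
  then have "is_subgraph H G"
    using G(1) Suc.prems by (auto simp: is_subgraph_def is_multigraph_def H_def)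
  moreover have "verts H \<noteq> {}"
    using Suc.hyps by (auto simp: H_def)
  ultimately obtain v where v: "v \<in> W" "Defs.degree H v \<le> d"
    using G(2) unfolding degenerate_def by (force simp: H_def)
  have W: "insert v (W - {v}) = W"
    using v by auto
  have "P (insert v (W - {v}))"
  proof (rule step)
    have "{e \<in> edges G. v \<in> ends G e \<and> ends G e \<subseteq> W} = {e \<in> edges H. v \<in> ends H e}"
      by (auto simp: H_def)
    then show "card {e \<in> edges G. v \<in> ends G e \<and> ends G e \<subseteq> insert v (W - {v})} \<le> d"
      unfolding W using v(2) by (simp add: Defs.degree_def)
    show "P (W - {v})"
      using Suc v by (intro Suc.hyps(1)) auto
  qed (use Suc.prems v in auto)
  then show ?case
    by (simp only: W)
qed

text \<open>Rank the vertices in the order in which \<open>degenerate_induct\<close> adds them. A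
  newcomer lies above all earlier vertices, so its edges do not enter their counts.\<close>

lemma degeneracy_order:
  assumes "is_multigraph G" "degenerate d G"
  shows "\<exists>r :: 'v \<Rightarrow> nat. inj_on r (verts G) \<and>
    (\<forall>v\<in>verts G. card {e \<in> edges G. v \<in> ends G e \<and> (\<forall>u\<in>ends G e. r u \<le> r v)} \<le> d)"
proof -
  have "\<exists>r :: 'v \<Rightarrow> nat. inj_on r W \<and> (\<forall>v\<in>W.
      card {e \<in> edges G. v \<in> ends G e \<and> ends G e \<subseteq> W \<and> (\<forall>u\<in>ends G e. r u \<le> r v)} \<le> d)"
    if "W \<subseteq> verts G" for W
    using assms that
  proof (induction rule: degenerate_induct)
    case (insert v W)
    then obtain r :: "'v \<Rightarrow> nat" where r: "inj_on r W" "\<And>w. w \<in> W \<Longrightarrow>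
        card {e \<in> edges G. w \<in> ends G e \<and> ends G e \<subseteq> W \<and> (\<forall>u\<in>ends G e. r u \<le> r w)} \<le> d"
      by blast
    have fin: "finite W" "finite (edges G)"
      using insert.hyps assms(1) finite_subset by (auto simp: is_multigraph_def)
    then obtain n where n: "\<And>w. w \<in> W \<Longrightarrow> r w < n"
      using finite_nat_set_iff_bounded[of "r ` W"] by auto
    define r' where "r' = r(v := n)"
    have "inj_on r' (insert v W)"
      using r(1) n insert.hyps by (force simp: r'_def inj_on_def)
    moreover have "card {e \<in> edges G. w \<in> ends G e \<and> ends G e \<subseteq> insert v W \<and>
        (\<forall>u\<in>ends G e. r' u \<le> r' w)} \<le> d" (is "card ?E \<le> d") if "w \<in> insert v W" for w
    proof (cases "w = v")
      case True
      then have "card ?E \<le> card {e \<in> edges G. v \<in> ends G e \<and> ends G e \<subseteq> insert v W}"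
        using fin by (intro card_mono) auto
      then show ?thesis
        using insert.hyps by linarith
    next
      case False
      with that have w: "w \<in> W"
        by simp
      have "?E \<subseteq> {e \<in> edges G. w \<in> ends G e \<and> ends G e \<subseteq> W \<and> (\<forall>u\<in>ends G e. r u \<le> r w)}"
      proof
        fix e assume e: "e \<in> ?E"
        then have r'_le: "r' u \<le> r w" if "u \<in> ends G e" for u
          using that False by (simp add: r'_def)
        then have "v \<notin> ends G e"
          using n[OF w] by (fastforce simp: r'_def)
        moreover from this have "r u \<le> r w" if "u \<in> ends G e" for u
          using r'_le[OF that] that by (metis r'_def fun_upd_other)
        ultimately show "e \<in> {e \<in> edges G. w \<in> ends G e \<and> ends G e \<subseteq> W \<and> (\<forall>u\<in>ends G e. r u \<le> r w)}"
          using e by blast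
      qed
      then have "card ?E \<le> card {e \<in> edges G. w \<in> ends G e \<and> ends G e \<subseteq> W \<and> (\<forall>u\<in>ends G e. r u \<le> r w)}"
        using fin by (intro card_mono) auto
      then show ?thesis
        using r(2)[OF w] by linarith
    qed
    ultimately show ?case
      by blast
  qed simp
  then obtain r :: "'v \<Rightarrow> nat" where r: "inj_on r (verts G)" "\<And>v. v \<in> verts G \<Longrightarrow>
      card {e \<in> edges G. v \<in> ends G e \<and> ends G e \<subseteq> verts G \<and> (\<forall>u\<in>ends G e. r u \<le> r v)} \<le> d"
    by blast
  have "{e \<in> edges G. v \<in> ends G e \<and> ends G e \<subseteq> verts G \<and> (\<forall>u\<in>ends G e. r u \<le> r v)} =
      {e \<in> edges G. v \<in> ends G e \<and> (\<forall>u\<in>ends G e. r u \<le> r v)}" for v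
    using assms(1) by (auto simp: is_multigraph_def)
  with r show ?thesis
    by auto
qed

text \<open>Makes the other end a function of the edge, so that sets of conflicts or neighbours can
  be counted as images of edge sets.\<close>

lemma some_other_end: "(SOME w. {u, v} = {w, v}) = u"
  by (rule some_equality) (auto simp: doubleton_eq_iff)

lemma conflict_function_swap:
  assumes "conflict_function G C f" "e \<in> edges G" "ends G e = {u, v}" "f e u v = (a, b)"
  shows "f e v u = (b, a)"
  using assms unfolding conflict_function_def by (metis prod.swap_def fst_conv snd_conv)

section \<open>Greedy coloring and coloring by activated colors\<close>

text \<open>Greedy choice: each edge from a new vertex to the colored ones forbids at most one
  color, and there are at most \<open>d\<close> such edges.\<close>

lemma coloring_if_card_gt_degeneracy:
  assumes G: "is_multigraph G" "degenerate d G" and f: "conflict_function G C f"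
    and C: "finite C" "d < card C"
  shows "\<exists>\<phi>. single_conflict_coloring G C f \<phi>"
proof -
  have "\<exists>\<phi>. \<phi> \<in> W \<rightarrow> C \<and> (\<forall>e\<in>edges G. ends G e \<subseteq> W \<longrightarrow>
      (\<forall>u v. ends G e = {u, v} \<longrightarrow> (\<phi> u, \<phi> v) \<noteq> f e u v))" if "W \<subseteq> verts G" for W
    using G that
  proof (induction rule: degenerate_induct)
    case empty
    have "ends G e \<noteq> {}" if "e \<in> edges G" for e
      using that G(1) by (auto simp: is_multigraph_def)
    then show ?case
      by auto
  next
    case (insert v W)
    from insert.IH obtain \<phi> where \<phi>: "\<phi> \<in> W \<rightarrow> C" "\<And>e u v. \<lbrakk>e \<in> edges G; ends G e \<subseteq> W; ends G e = {u, v}\<rbrakk> \<Longrightarrow>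
        (\<phi> u, \<phi> v) \<noteq> f e u v"
      by blast
    define E where "E = {e \<in> edges G. v \<in> ends G e \<and> ends G e \<subseteq> insert v W}"
    define F where "F = {c. \<exists>e\<in>E. \<exists>u. ends G e = {u, v} \<and> f e u v = (\<phi> u, c)}"
    have "finite E"
      using G(1) by (simp add: E_def is_multigraph_def)
    have "F \<subseteq> (\<lambda>e. snd (f e (SOME u. ends G e = {u, v}) v)) ` E"
    proof
      fix c assume "c \<in> F"
      then obtain e u where "e \<in> E" "ends G e = {u, v}" "f e u v = (\<phi> u, c)"
        by (auto simp: F_def)
      then show "c \<in> (\<lambda>e. snd (f e (SOME u. ends G e = {u, v}) v)) ` E"
        by (intro image_eqI[of _ _ e]) (simp_all add: some_other_end)
    qed
    then have "card F \<le> card E" "finite F"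
      by (rule surj_card_le[OF \<open>finite E\<close>], rule finite_surj[OF \<open>finite E\<close>])
    moreover have "card E \<le> d"
      using insert.hyps by (simp add: E_def)
    ultimately have "\<not> C \<subseteq> F"
      using C(2) card_mono[of F C] by linarith
    then obtain c where c: "c \<in> C" "c \<notin> F"
      by blast
    define \<phi>' where "\<phi>' = \<phi>(v := c)"
    have "\<phi>' \<in> insert v W \<rightarrow> C"
      using \<phi>(1) c(1) by (auto simp: \<phi>'_def)
    moreover have "(\<phi>' a, \<phi>' b) \<noteq> f e a b"
      if e: "e \<in> edges G" "ends G e \<subseteq> insert v W" "ends G e = {a, b}" for e a b
    proof
      assume eq: "(\<phi>' a, \<phi>' b) = f e a b"
      have "a \<noteq> b"
        using e G(1) by (auto simp: is_multigraph_def)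
      consider "a \<noteq> v" "b \<noteq> v" | "b = v" | "a = v"
        by blast
      then show False
      proof cases
        case 1
        then have "(\<phi> a, \<phi> b) \<noteq> f e a b"
          using e by (intro \<phi>(2)) auto
        then show False
          using eq 1 by (simp add: \<phi>'_def)
      next
        case 2
        then have "e \<in> E" "ends G e = {a, v}" "f e a v = (\<phi> a, c)"
          using e eq \<open>a \<noteq> b\<close> by (simp_all add: E_def \<phi>'_def)
        then have "c \<in> F"
          unfolding F_def by blast
        then show False
          using c by simp
      next
        case 3
        have "f e b a = (\<phi>' b, \<phi>' a)"
          using conflict_function_swap[OF f e(1,3) eq[symmetric]] .
        then have "e \<in> E" "ends G e = {b, v}" "f e b v = (\<phi> b, c)"
          using e 3 \<open>a \<noteq> b\<close> by (simp_all add: E_def \<phi>'_def insert_commute)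
        then have "c \<in> F"
          unfolding F_def by blast
        then show False
          using c by simp
      qed
    qed
    ultimately show ?case
      by blast
  qed
  from this[of "verts G"] obtain \<phi> where \<phi>: "\<phi> \<in> verts G \<rightarrow> C"
      "\<And>e u v. \<lbrakk>e \<in> edges G; ends G e \<subseteq> verts G; ends G e = {u, v}\<rbrakk> \<Longrightarrow> (\<phi> u, \<phi> v) \<noteq> f e u v"
    by blast
  moreover have "ends G e \<subseteq> verts G" if "e \<in> edges G" for e
    using that G(1) by (simp add: is_multigraph_def)
  ultimately have "single_conflict_coloring G C f \<phi>"
    unfolding single_conflict_coloring_def by blast
  then show ?thesis
    by blast
qed

text \<open>Orient every edge towards its end of higher rank and give each vertex an activated
  unblocked color. The color taken at the earlier end is itself activated, so it would block the
  color at the later end if the two formed the conflict.\<close>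

lemma coloring_if_card_le_degeneracy:
  assumes G: "is_multigraph G" "degenerate d G" and f: "conflict_function G C f"
    and C: "finite C" "card C \<le> d" and pos: "0 < \<mu>" "0 < \<Delta>" "0 < d"
    and deg: "\<And>v. v \<in> verts G \<Longrightarrow> Defs.degree G v \<le> \<Delta>"
    and mult: "\<And>u v. \<lbrakk>u \<in> verts G; v \<in> verts G\<rbrakk> \<Longrightarrow> card {e \<in> edges G. ends G e = {u, v}} \<le> \<mu>"
    and small: "4 * exp (- (real (card C))\<^sup>2 / (4 * d * \<mu>)) * ((d + 1) * \<Delta>) \<le> 1"
  shows "\<exists>\<phi>. single_conflict_coloring G C f \<phi>"
proof -
  obtain r :: "'a \<Rightarrow> nat" where r: "inj_on r (verts G)" "\<And>v. v \<in> verts G \<Longrightarrow>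
      card {e \<in> edges G. v \<in> ends G e \<and> (\<forall>u\<in>ends G e. r u \<le> r v)} \<le> d"
    using degeneracy_order[OF G] by blast
  have fin: "finite (verts G)" "finite (edges G)"
    using G(1) by (auto simp: is_multigraph_def)
  define B where "B v = {(u, a, c). \<exists>e\<in>edges G. ends G e = {u, v} \<and> r u < r v \<and> f e u v = (a, c)}" for v
  have "\<exists>S. \<forall>v\<in>verts G. \<exists>c\<in>C. S (v, c) \<and> (\<forall>u a. (u, a, c) \<in> B v \<longrightarrow> \<not> S (u, a))"
  proof (rule exists_unblocked_choice[where d = d and m = \<mu> and D = \<Delta>])
    fix v assume v: "v \<in> verts G"
    show "B v \<subseteq> verts G \<times> C \<times> C"
    proof
      fix t assume "t \<in> B v"
      then obtain u a c e where t: "t = (u, a, c)" "e \<in> edges G" "ends G e = {u, v}" "f e u v = (a, c)"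
        by (auto simp: B_def)
      have "f e u v \<in> C \<times> C"
        using f t(2,3) unfolding conflict_function_def by blast
      moreover have "ends G e \<subseteq> verts G"
        using t(2) G(1) unfolding is_multigraph_def by blast
      ultimately show "t \<in> verts G \<times> C \<times> C"
        using t by simp
    qed
    show "v \<notin> fst ` B v"
      by (auto simp: B_def)
    let ?E = "{e \<in> edges G. v \<in> ends G e \<and> (\<forall>u\<in>ends G e. r u \<le> r v)}"
    \<comment> \<open>Every triple comes from an edge to an earlier vertex, and there are at most
      \<open>d\<close> of these.\<close>
    have "B v \<subseteq> (\<lambda>e. let u = SOME u. ends G e = {u, v} in (u, f e u v)) ` ?E"
    proof
      fix t assume "t \<in> B v"
      then obtain u a c e where "t = (u, a, c)" "e \<in> edges G" "ends G e = {u, v}" "r u < r v" "f e u v = (a, c)"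
        by (auto simp: B_def)
      then show "t \<in> (\<lambda>e. let u = SOME u. ends G e = {u, v} in (u, f e u v)) ` ?E"
        by (intro image_eqI[of _ _ e]) (auto simp: some_other_end)
    qed
    then have "card (B v) \<le> card ?E"
      using fin by (intro surj_card_le) auto
    then show "card (B v) \<le> d"
      using r(2)[OF v] by linarith
    fix u
    show "card {t \<in> B v. fst t = u} \<le> \<mu>"
    proof (cases "u \<in> verts G")
      case True
      have "{t \<in> B v. fst t = u} \<subseteq> (\<lambda>e. (u, f e u v)) ` {e \<in> edges G. ends G e = {u, v}}"
        by (force simp: B_def)
      then have "card {t \<in> B v. fst t = u} \<le> card {e \<in> edges G. ends G e = {u, v}}"
        using fin by (intro surj_card_le) auto
      then show ?thesis
        using mult[OF True v] by linarith
    next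
      case False
      then have "{t \<in> B v. fst t = u} = {}"
        using G(1) by (fastforce simp: B_def is_multigraph_def)
      then show ?thesis
        by (simp only: card.empty zero_le)
    qed
  next
    fix u assume u: "u \<in> verts G"
    have "{v \<in> verts G. u \<in> fst ` B v} \<subseteq> (\<lambda>e. SOME v. ends G e = {v, u}) ` {e \<in> edges G. u \<in> ends G e}"
    proof
      fix v assume "v \<in> {v \<in> verts G. u \<in> fst ` B v}"
      then obtain e where "e \<in> edges G" "ends G e = {u, v}"
        by (auto simp: B_def)
      then have "e \<in> edges G" "ends G e = {v, u}"
        by (simp_all only: insert_commute)
      then show "v \<in> (\<lambda>e. SOME v. ends G e = {v, u}) ` {e \<in> edges G. u \<in> ends G e}"
        by (intro image_eqI[of _ _ e]) (simp_all add: some_other_end)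
    qed
    then have "card {v \<in> verts G. u \<in> fst ` B v} \<le> Defs.degree G u"
      unfolding Defs.degree_def by (rule surj_card_le[rotated]) (simp add: fin)
    then show "card {v \<in> verts G. u \<in> fst ` B v} \<le> \<Delta>"
      using deg[OF u] by linarith
  qed (fact fin C pos small)+
  then obtain S where S: "\<forall>v\<in>verts G. \<exists>c. c \<in> C \<and> S (v, c) \<and> (\<forall>u a. (u, a, c) \<in> B v \<longrightarrow> \<not> S (u, a))"
    unfolding Bex_def by (elim exE)
  from bchoice[OF this] obtain \<phi> where \<phi>: "\<And>v. v \<in> verts G \<Longrightarrow> \<phi> v \<in> C"
      "\<And>v. v \<in> verts G \<Longrightarrow> S (v, \<phi> v)"
      "\<And>u v a. \<lbrakk>v \<in> verts G; (u, a, \<phi> v) \<in> B v\<rbrakk> \<Longrightarrow> \<not> S (u, a)"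
    by blast
  have no: False
    if e: "e \<in> edges G" "ends G e = {u, v}" and lt: "r u < r v" and eq: "f e u v = (\<phi> u, \<phi> v)" for e u v
  proof -
    have "u \<in> verts G" "v \<in> verts G"
      using e G(1) by (auto simp: is_multigraph_def)
    moreover have "(u, \<phi> u, \<phi> v) \<in> B v"
      using that by (auto simp: B_def)
    ultimately show False
      using \<phi> by blast
  qed
  have "(\<phi> u, \<phi> v) \<noteq> f e u v" if e: "e \<in> edges G" "ends G e = {u, v}" for e u v
  proof
    assume eq: "(\<phi> u, \<phi> v) = f e u v"
    have "u \<in> verts G" "v \<in> verts G" "u \<noteq> v"
      using e G(1) by (auto simp: is_multigraph_def)
    then consider "r u < r v" | "r v < r u"
      using r(1) by (meson inj_onD linorder_neqE_nat)
    then show False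
    proof cases
      case 1
      then show False
        using no[OF e 1] eq by simp
    next
      case 2
      have "f e v u = (\<phi> v, \<phi> u)"
        using conflict_function_swap[OF f e eq[symmetric]] .
      then show False
        using no[of e v u] e 2 by (simp add: insert_commute)
    qed
  qed
  then have "single_conflict_coloring G C f \<phi>"
    using \<phi>(1) by (simp add: single_conflict_coloring_def)
  then show ?thesis
    by blast
qed

theorem theorem1p9:
  fixes G :: "('v, 'e) multigraph" and d \<Delta> \<mu> :: nat
  assumes "is_multigraph G"
    and "edges G \<noteq> {}"
    and "degenerate d G"
    and "max_degree G = \<Delta>"
    and "edge_multiplicity G \<le> \<mu>"
  shows "int (chi_con G) \<le>
    \<lceil>sqrt (real d) * 2 powr (real \<mu> / 2 + 2) * sqrt (real \<mu>)
       * sqrt (1 + ln ((real d + 1) * real \<Delta>))\<rceil>"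
proof -
  have fin: "finite (verts G)" "finite (edges G)"
    using assms(1) by (auto simp: is_multigraph_def)
  have deg: "Defs.degree G v \<le> \<Delta>" if "v \<in> verts G" for v
    using that fin assms(4) by (auto simp: max_degree_def intro: Max_ge)
  have mult: "card {e \<in> edges G. ends G e = {u, v}} \<le> \<mu>" if "u \<in> verts G" "v \<in> verts G" for u v
  proof -
    have "card {e \<in> edges G. ends G e = {u, v}} \<le> edge_multiplicity G"
      unfolding edge_multiplicity_def using that fin by (intro Max_ge) auto
    then show ?thesis
      using assms(5) by linarith
  qed
  obtain e u v where e: "e \<in> edges G" "ends G e = {u, v}"
    using assms(1,2) unfolding is_multigraph_def by (meson card_2_iff ex_in_conv)
  have uv: "u \<in> verts G" "v \<in> verts G"
    using e assms(1) by (auto simp: is_multigraph_def)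
  have \<mu>: "0 < \<mu>"
  proof -
    have "0 < card {e \<in> edges G. ends G e = {u, v}}"
      using e fin by (auto simp: card_gt_0_iff)
    then show ?thesis
      using mult[OF uv] by linarith
  qed
  have \<Delta>: "0 < \<Delta>"
  proof -
    have "0 < Defs.degree G u"
      using e fin by (auto simp: Defs.degree_def card_gt_0_iff)
    then show ?thesis
      using deg[OF uv(1)] by linarith
  qed
  have d: "0 < d"
  proof -
    obtain r :: "'v \<Rightarrow> nat" where r: "\<And>v. v \<in> verts G \<Longrightarrow>
        card {e \<in> edges G. v \<in> ends G e \<and> (\<forall>u\<in>ends G e. r u \<le> r v)} \<le> d"
      using degeneracy_order[OF assms(1,3)] by blast
    \<comment> \<open>The end of \<open>e\<close> with the larger rank has \<open>e\<close> among
      its at most \<open>d\<close> backward edges.\<close>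
    obtain w where w: "w \<in> {u, v}" "\<forall>z\<in>{u, v}. r z \<le> r w"
      by (cases "r u \<le> r v") force+
    have "0 < card {e \<in> edges G. w \<in> ends G e \<and> (\<forall>u\<in>ends G e. r u \<le> r w)}"
      using e w fin by (auto simp: card_gt_0_iff)
    then show ?thesis
      using r[of w] w uv by auto
  qed
  define M where "M = (real d + 1) * real \<Delta>"
  define L where "L = 1 + ln M"
  define K where "K = sqrt d * 2 powr (\<mu> / 2 + 2) * sqrt \<mu> * sqrt L"
  define k where "k = nat \<lceil>K\<rceil>"
  have "1 * 1 \<le> M"
    unfolding M_def using \<Delta> by (intro mult_mono) auto
  then have M: "1 \<le> M"
    by simp
  then have L: "1 \<le> L"
    by (simp add: L_def)
  have K: "0 < K"
    using d \<mu> L by (simp add: K_def)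
  then have k: "1 \<le> k" "K \<le> k"
    unfolding k_def by linarith+
  have K2: "16 * (d * \<mu> * L) \<le> K\<^sup>2"
  proof -
    \<comment> \<open>The resulting factor \<open>4\<close> is the source of the \<open>16\<close>
      after squaring.\<close>
    have "(2::real) powr 2 \<le> 2 powr (\<mu> / 2 + 2)"
      by (intro powr_mono) auto
    then have "sqrt d * 4 * sqrt \<mu> * sqrt L \<le> K"
      unfolding K_def using L by (intro mult_right_mono mult_left_mono) auto
    then have "(sqrt d * 4 * sqrt \<mu> * sqrt L)\<^sup>2 \<le> K\<^sup>2"
      using L by (intro power_mono) auto
    then show ?thesis
      using L by (simp add: power_mult_distrib)
  qed
  have small: "4 * exp (- (real k)\<^sup>2 / (4 * d * \<mu>)) * ((d + 1) * \<Delta>) \<le> 1"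
  proof -
    have "16 * (d * \<mu> * L) \<le> (real k)\<^sup>2"
      using K2 power_mono[OF k(2), of 2] K by linarith
    then have "4 * L \<le> (real k)\<^sup>2 / (4 * d * \<mu>)"
      using d \<mu> by (simp add: field_simps)
    then have "- (real k)\<^sup>2 / (4 * d * \<mu>) \<le> - (2 * L)"
      using L by simp
    \<comment> \<open>The summand \<open>2\<close> pays for the factor \<open>4\<close> of the local
      lemma, since \<open>exp (- 2) \<le> 1 / 4\<close>; the summand \<open>ln M\<close> cancels the
      bound \<open>M\<close> on the number of dependent events.\<close>
    also have "\<dots> \<le> - (2 + ln M)"
      using M by (simp add: L_def)
    finally have "exp (- (real k)\<^sup>2 / (4 * d * \<mu>)) \<le> exp (- (2 + ln M))"
      by simp
    also have "\<dots> = exp (- 2) / M"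
      using M by (simp only: minus_add_distrib flip: diff_conv_add_uminus) (simp add: exp_diff)
    finally have "exp (- (real k)\<^sup>2 / (4 * d * \<mu>)) * M \<le> exp (- 2)"
      using M by (simp add: field_simps)
    moreover have "4 * exp (- 2) \<le> (1 :: real)"
    proof -
      have "(2 :: real)\<^sup>2 \<le> (exp 1)\<^sup>2"
        using exp_ge_add_one_self[of 1] by (intro power_mono) auto
      then show ?thesis
        by (simp add: exp_minus field_simps flip: exp_of_nat_mult)
    qed
    ultimately show ?thesis
      by (simp add: M_def algebra_simps)
  qed
  have "chi_con G \<le> k"
    unfolding chi_con_def
  proof (intro Least_le conjI allI impI)
    fix C :: "nat set" and f
    assume C: "card C = k" and f: "conflict_function G C f"
    have "finite C"
      using C k(1) card_ge_0_finite[of C] by simp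
    then show "\<exists>\<phi>. single_conflict_coloring G C f \<phi>"
    proof (cases "d < card C")
      case True
      then show ?thesis
        using coloring_if_card_gt_degeneracy[OF assms(1,3) f \<open>finite C\<close>] by simp
    next
      case False
      then show ?thesis
        using small C \<mu> \<Delta> d deg mult \<open>finite C\<close>
        by (intro coloring_if_card_le_degeneracy[OF assms(1,3) f]) auto
    qed
  qed (rule k(1))
  then have "int (chi_con G) \<le> \<lceil>K\<rceil>"
    using K unfolding k_def by linarith
  then show ?thesis
    by (simp add: K_def L_def M_def)
qed

end
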